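(* Let $S\subseteq\mathbb{N}^s$ be a good semigroup, let $E$ be a good semigroup ideal of $S$, and let $K$ be the (normalized) canonical ideal of $S$. Suppose that one of the following (equivalent) conditions holds: (i) $\mathrm{d}(D_S^{\mu^E}\backslash E)=\mathrm{d}\big((K-E)\backslash D_S^{\gamma-\mu^E}\big)$; (ii) $\mathrm{d}(E\backslash E^{\gamma^E})=\mathrm{d}(D_S^{\mu^E}\backslash D_S^{\gamma^E})-\mathrm{d}\big((K-E)\backslash (K-E)^{\gamma-\mu^E}\big)$; (iii) for all $\alpha\in D_S$ with $\mu^E\le\alpha\le\gamma^E$ and every $i\in\{1,\dots,s\}$ such that $\alpha+\mathbf{e}_i\le\gamma^E$: $\overline\Delta^E_i(\alpha)\neq\emptyset \iff \Delta_i^{K-E}(\tau-\alpha)=\emptyset$; (iv) for all $\alpha\in D_S$ with $\mu^E\le\alpha\le\gamma^E$ and every $i\in\{1,\dots,s\}$ such that $\alpha-\mathbf{e}_i\ge\mu^E$: $\overline\Delta_i^{K-E}(\tau-\alpha)\neq\emptyset \iff \Delta^E_i(\alpha)=\emptyset$. Then the Poincaré series of $E$ and $K-E$ are symmetric: $$\mathrm{P}_{K-E}(\mathbf{t})=(-1)^{s+1}\,\mathbf{t}^{\gamma}\,\mathrm{P}_E\!\left(\frac{1}{\mathbf{t}}\right).$$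
   Context: Let $D_S=\mathbb{Z}^s$ with the componentwise partial order ($\alpha<\beta$ means $\alpha\le\beta$, $\alpha\ne\beta$), $\mathbf{e}_i$ the $i$-th standard basis vector, $\mathbf{1}=(1,\dots,1)$. For $E\subseteq\mathbb{Z}^s$ consider: (E0) there is $\alpha\in\mathbb{Z}^s$ with $\alpha+\mathbb{N}^s\subseteq E$; (E1) $\alpha,\beta\in E$ implies $\min\{\alpha,\beta\}$ (componentwise) $\in E$; (E2) for $\alpha,\beta\in E$ and $j$ with $\alpha_j=\beta_j$ there is $\epsilon\in E$ with $\epsilon_j>\alpha_j$ and $\epsilon_i\ge\min\{\alpha_i,\beta_i\}$ for all $i\ne j$, with equality if $\alpha_i\ne\beta_i$. A good semigroup is a submonoid $S\subseteq\mathbb{N}^s$ satisfying (E0), (E1), (E2). A semigroup ideal of $S$ is a nonempty $E\subseteq D_S$ with $E+S\subseteq E$ and $\alpha+E\subseteq S$ for some $\alpha\in S$; it is good if it satisfies (E1) and (E2). For a good semigroup ideal $E$: $\mu^E=\min E$ and $\gamma^E=\min\{\alpha\in D_S\mid\alpha+\mathbb{N}^s\subseteq E\}$. Put $\gamma=\gamma^S$, $\tau=\gamma-\mathbf{1}$. For semigroup ideals $E,F$: $E-F=\{\alpha\in D_S\mid\alpha+F\subseteq E\}$. For $\alpha\in D_S$: $E^\alpha=\{\beta\in E\mid\beta\ge\alpha\}$ and $D_S^\alpha=\{\beta\in D_S\mid\beta\ge\alpha\}=\alpha+\mathbb{N}^s$; these are good semigroup ideals of $S$. Sets: $\Delta^E_i(\alpha)=\{\beta\in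 E\mid\beta_i=\alpha_i,\ \beta_j>\alpha_j\ \forall j\ne i\}$, $\overline\Delta^E_i(\alpha)=\{\beta\in E\mid\beta_i=\alpha_i,\ \beta_j\ge\alpha_j\ \forall j\ne i\}$, $\Delta^E(\alpha)=\bigcup_{i=1}^s\Delta^E_i(\alpha)$. The (normalized) canonical ideal of $S$ is $K=\{\alpha\in D_S\mid\Delta^S(\tau-\alpha)=\emptyset\}$; it is a good semigroup ideal, and $K-E$ is a good semigroup ideal for every good semigroup ideal $E$. Distance: $\alpha<\beta$ in $E$ are consecutive in $E$ if no $\delta\in E$ satisfies $\alpha<\delta<\beta$. A chain $\alpha=\alpha^{(0)}<\dots<\alpha^{(n)}=\beta$ in $E$ is saturated of length $n$ if successive elements are consecutive in $E$. In a good semigroup ideal all saturated chains between two fixed points $\alpha\le\beta$ have the same length (known result of D'Anna), denoted $\mathrm{d}_E(\alpha,\beta)$. For good semigroup ideals $E\subseteq F$, $\mathrm{d}(F\backslash E):=\mathrm{d}_F(\mu^F,\gamma^E)-\mathrm{d}_E(\mu^E,\gamma^E)$. Poincaré series: for a good semigroup ideal $E$ and $\alpha\in D_S$, $\mathrm{d}_E(\alpha):=\mathrm{d}(E^\alpha\backslash E^{\alpha+\mathbf{1}})$; $\mathrm{L}_E(\mathbf{t}):=\sum_{\alpha\in D_S}\mathrm{d}_E(\alpha)\mathbf{t}^\alpha$, a formal series in $\mathbf{t}=(t_1,\dots,t_s)$ with exponents in $\mathbb{Z}^s$, $\mathbf{t}^\alpha=t_1^{\alpha_1}\cdots t_s^{\alpha_s}$;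 and $\mathrm{P}_E(\mathbf{t}):=\mathrm{L}_E(\mathbf{t})\prod_{i=1}^s(t_i-1)$. $\mathrm{P}_E(1/\mathbf{t})$ is obtained by substituting $t_i^{-1}$ for $t_i$. *)

theory Defs
  imports "HOL-Analysis.Finite_Cartesian_Product" "HOL-Library.Poly_Mapping"
begin

text \<open>
  The index type \<open>'n\<close> stands for \<open>{1, \<dots>, s}\<close>, so \<open>s = CARD('n)\<close>, and
  \<open>D\<^sub>S = \<int>\<^sup>s\<close> is the whole type \<open>int ^ 'n\<close>. The library order on vectors is the componentwise
  one, with \<open>x < y\<close> meaning \<open>x \<le> y\<close> and \<open>x \<noteq> y\<close>; moreover \<open>1\<close> is the all-ones vector,
  \<open>axis i 1\<close> is the standard basis vector \<open>e\<^sub>i\<close>, \<open>{\<alpha>..}\<close> is \<open>\<alpha> + \<nat>\<^sup>s\<close>, and \<open>LEAST\<close> yields the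
  minimum with respect to this partial order.
\<close>

definition prop_E0 :: "(int ^ 'n) set \<Rightarrow> bool" where
  "prop_E0 E \<longleftrightarrow> (\<exists>\<alpha>. {\<alpha>..} \<subseteq> E)"

definition prop_E1 :: "(int ^ 'n) set \<Rightarrow> bool" where
  "prop_E1 E \<longleftrightarrow> (\<forall>\<alpha>\<in>E. \<forall>\<beta>\<in>E. (\<chi> i. min (\<alpha> $ i) (\<beta> $ i)) \<in> E)"

definition prop_E2 :: "(int ^ 'n) set \<Rightarrow> bool" where
  "prop_E2 E \<longleftrightarrow>
     (\<forall>\<alpha>\<in>E. \<forall>\<beta>\<in>E. \<forall>j. \<alpha> $ j = \<beta> $ j \<longrightarrow>
       (\<exists>\<epsilon>\<in>E. \<epsilon> $ j > \<alpha> $ j \<and>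
          (\<forall>i. i \<noteq> j \<longrightarrow> \<epsilon> $ i \<ge> min (\<alpha> $ i) (\<beta> $ i) \<and>
             (\<alpha> $ i \<noteq> \<beta> $ i \<longrightarrow> \<epsilon> $ i = min (\<alpha> $ i) (\<beta> $ i)))))"

definition good_semigroup :: "(int ^ 'n) set \<Rightarrow> bool" where
  "good_semigroup S \<longleftrightarrow>
     S \<subseteq> {0..} \<and> 0 \<in> S \<and> (\<forall>\<alpha>\<in>S. \<forall>\<beta>\<in>S. \<alpha> + \<beta> \<in> S) \<and>
     prop_E0 S \<and> prop_E1 S \<and> prop_E2 S"

definition semigroup_ideal :: "(int ^ 'n) set \<Rightarrow> (int ^ 'n) set \<Rightarrow> bool" where
  "semigroup_ideal S E \<longleftrightarrow>
     E \<noteq> {} \<and> (\<forall>\<alpha>\<in>E. \<forall>\<beta>\<in>S. \<alpha> + \<beta> \<in> E) \<and> (\<exists>\<alpha>\<in>S. \<forall>\<beta>\<in>E. \<alpha> + \<beta> \<in> S)"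

definition good_ideal :: "(int ^ 'n) set \<Rightarrow> (int ^ 'n) set \<Rightarrow> bool" where
  "good_ideal S E \<longleftrightarrow> semigroup_ideal S E \<and> prop_E1 E \<and> prop_E2 E"

definition minimum :: "(int ^ 'n) set \<Rightarrow> int ^ 'n" where
  "minimum E = (LEAST \<alpha>. \<alpha> \<in> E)"

definition conductor :: "(int ^ 'n) set \<Rightarrow> int ^ 'n" where
  "conductor E = (LEAST \<alpha>. {\<alpha>..} \<subseteq> E)"

definition ideal_diff :: "(int ^ 'n) set \<Rightarrow> (int ^ 'n) set \<Rightarrow> (int ^ 'n) set" where
  "ideal_diff E F = {\<alpha>. \<forall>\<beta>\<in>F. \<alpha> + \<beta> \<in> E}"

definition truncation :: "(int ^ 'n) set \<Rightarrow> int ^ 'n \<Rightarrow> (int ^ 'n) set" where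
  "truncation E \<alpha> = {\<beta> \<in> E. \<beta> \<ge> \<alpha>}"

definition Delta_at :: "(int ^ 'n) set \<Rightarrow> 'n \<Rightarrow> int ^ 'n \<Rightarrow> (int ^ 'n) set" where
  "Delta_at E i \<alpha> = {\<beta> \<in> E. \<beta> $ i = \<alpha> $ i \<and> (\<forall>j. j \<noteq> i \<longrightarrow> \<beta> $ j > \<alpha> $ j)}"

definition Delta_bar_at :: "(int ^ 'n) set \<Rightarrow> 'n \<Rightarrow> int ^ 'n \<Rightarrow> (int ^ 'n) set" where
  "Delta_bar_at E i \<alpha> = {\<beta> \<in> E. \<beta> $ i = \<alpha> $ i \<and> (\<forall>j. j \<noteq> i \<longrightarrow> \<beta> $ j \<ge> \<alpha> $ j)}"

definition Delta :: "(int ^ 'n) set \<Rightarrow> int ^ 'n \<Rightarrow> (int ^ 'n) set" where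
  "Delta E \<alpha> = (\<Union>i. Delta_at E i \<alpha>)"

definition canonical_ideal :: "(int ^ 'n) set \<Rightarrow> (int ^ 'n) set" where
  "canonical_ideal S = {\<alpha>. Delta S (conductor S - 1 - \<alpha>) = {}}"


definition consecutive :: "(int ^ 'n) set \<Rightarrow> int ^ 'n \<Rightarrow> int ^ 'n \<Rightarrow> bool" where
  "consecutive E \<alpha> \<beta> \<longleftrightarrow>
     \<alpha> \<in> E \<and> \<beta> \<in> E \<and> \<alpha> < \<beta> \<and> \<not> (\<exists>\<delta>\<in>E. \<alpha> < \<delta> \<and> \<delta> < \<beta>)"

definition saturated_chain ::
    "(int ^ 'n) set \<Rightarrow> int ^ 'n \<Rightarrow> int ^ 'n \<Rightarrow> nat \<Rightarrow> (nat \<Rightarrow> int ^ 'n) \<Rightarrow> bool" where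
  "saturated_chain E \<alpha> \<beta> n c \<longleftrightarrow>
     c 0 = \<alpha> \<and> c n = \<beta> \<and> (\<forall>k\<le>n. c k \<in> E) \<and> (\<forall>k<n. consecutive E (c k) (c (Suc k)))"

text \<open>
  The common length of all saturated chains from \<open>\<alpha>\<close> to \<open>\<beta>\<close> in \<open>E\<close>; meaningful for a good
  semigroup ideal \<open>E\<close> and \<open>\<alpha> \<le> \<beta>\<close> in \<open>E\<close>, where this length exists and is unique.
\<close>
definition chain_dist :: "(int ^ 'n) set \<Rightarrow> int ^ 'n \<Rightarrow> int ^ 'n \<Rightarrow> nat" where
  "chain_dist E \<alpha> \<beta> = (THE n. \<exists>c. saturated_chain E \<alpha> \<beta> n c)"

text \<open>\<open>ideal_dist F E\<close> is \<open>d(F \ E)\<close>, for good semigroup ideals \<open>E \<subseteq> F\<close>.\<close>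
definition ideal_dist :: "(int ^ 'n) set \<Rightarrow> (int ^ 'n) set \<Rightarrow> int" where
  "ideal_dist F E =
     int (chain_dist F (minimum F) (conductor E)) - int (chain_dist E (minimum E) (conductor E))"


text \<open>
  A formal series in \<open>t = (t\<^sub>1, \<dots>, t\<^sub>s)\<close> with exponents in \<open>\<int>\<^sup>s\<close>, possibly infinite in all
  directions, is given by its coefficient function. Such series form a module over the ring of
  Laurent polynomials, which are the finitely supported functions on exponents.
\<close>
type_synonym 'n series = "int ^ 'n \<Rightarrow> int"
type_synonym 'n laurent_poly = "(int ^ 'n) \<Rightarrow>\<^sub>0 int"

definition laurent_mult :: "('n::finite) laurent_poly \<Rightarrow> ('n::finite) series \<Rightarrow> ('n::finite) series" where
  "laurent_mult p f = (\<lambda>\<alpha>. \<Sum>\<beta>\<in>Poly_Mapping.keys p. Poly_Mapping.lookup p \<beta> * f (\<alpha> - \<beta>))"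

definition laurent_monom :: "int \<Rightarrow> int ^ 'n \<Rightarrow> ('n::finite) laurent_poly" where
  "laurent_monom c \<alpha> = Poly_Mapping.single \<alpha> c"

definition invert_vars :: "('n::finite) series \<Rightarrow> ('n::finite) series" where
  "invert_vars f = (\<lambda>\<alpha>. f (- \<alpha>))"

definition L_series :: "(int ^ 'n) set \<Rightarrow> ('n::finite) series" where
  "L_series E = (\<lambda>\<alpha>. ideal_dist (truncation E \<alpha>) (truncation E (\<alpha> + 1)))"

definition poincare_series :: "(int ^ 'n) set \<Rightarrow> ('n::finite) series" where
  "poincare_series E = laurent_mult (\<Prod>i\<in>UNIV. laurent_monom 1 (axis i 1) - 1) (L_series E)"

text \<open>The monomial \<open>c t\<^sup>\<alpha>\<close> acts by shifting exponents by \<open>\<alpha>\<close> and scaling by \<open>c\<close>.\<close>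
lemma laurent_mult_monom: "laurent_mult (laurent_monom c \<alpha>) f = (\<lambda>\<beta>. c * f (\<beta> - \<alpha>))"
  by (auto simp: laurent_mult_def laurent_monom_def)

end

theory Submission
  imports Defs
begin

text \<open>
  By (E2) there is a function \<open>h\<close> on \<open>\<int>\<^sup>s\<close> which increases by 1 from \<open>\<alpha>\<close> to \<open>\<alpha> + e\<^sub>i\<close> if the closed
  \<open>\<Delta>\<^sub>i\<close> of \<open>E\<close> at \<open>\<alpha>\<close> is nonempty, and stays the same otherwise. Saturated chains in \<open>E\<close> climb \<open>h\<close> by
  exactly 1 per step, so the coefficient of \<open>L\<^sub>E\<close> at \<open>\<alpha>\<close> is \<open>h(\<alpha> + 1) - h(\<alpha>)\<close>. Since
  \<open>K - E = {\<alpha>. \<Delta>\<^sup>E(\<tau> - \<alpha>) = \<emptyset>}\<close>, the closed \<open>\<Delta>\<^sub>i\<close> of \<open>K - E\<close> at \<open>\<beta>\<close> is nonempty iff that of \<open>E\<close> at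
  \<open>\<gamma> - \<beta> - e\<^sub>i\<close> is empty, so \<open>\<beta> \<mapsto> \<Sum>\<^sub>i \<beta>\<^sub>i + h(\<gamma> - \<beta>)\<close> is such a function for \<open>K - E\<close>. Hence the
  coefficient of \<open>L\<^bsub>K-E\<^esub>\<close> at \<open>\<alpha>\<close> is \<open>s\<close> minus that of \<open>L\<^sub>E\<close> at \<open>\<tau> - \<alpha>\<close>; the product of the \<open>t\<^sub>i - 1\<close>
  kills the constant and turns the reflection into the claimed symmetry.
\<close>

section \<open>Coordinates and the componentwise order\<close>

lemma axis_nth_if [simp]: "axis i x $ j = (if j = i then x else 0)"
  by (simp add: axis_def)

lemma vec_le_iff: "(\<alpha> :: int ^ 'n) \<le> \<beta> \<longleftrightarrow> (\<forall>i. \<alpha> $ i \<le> \<beta> $ i)"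
  by (simp add: less_eq_vec_def)

lemma Delta_bar_at_nonemptyE:
  assumes "Delta_bar_at E i \<alpha> \<noteq> {}"
  obtains \<beta> where "\<beta> \<in> E" "\<beta> $ i = \<alpha> $ i" "\<And>j. \<alpha> $ j \<le> \<beta> $ j"
proof -
  obtain \<beta> where \<beta>: "\<beta> \<in> Delta_bar_at E i \<alpha>" using assms by blast
  then have "\<alpha> $ j \<le> \<beta> $ j" for j
    by (cases "j = i") (auto simp: Delta_bar_at_def)
  with \<beta> that show ?thesis by (auto simp: Delta_bar_at_def)
qed

lemma vec_less_obtains_index:
  fixes \<alpha> \<beta> :: "int ^ 'n"
  assumes "\<alpha> < \<beta>"
  obtains i where "\<alpha> $ i < \<beta> $ i"
  using assms by (metis less_eq_vec_def linorder_not_less order.strict_iff_not)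

section \<open>Minima and conductors\<close>

text \<open>An element of least coordinate sum exists because \<open>m\<close> bounds
  \<open>A\<close> from below. If it were not below some \<open>y\<close> in \<open>A\<close>, its
  componentwise minimum with \<open>y\<close> would have a smaller sum.\<close>

lemma min_closed_has_least:
  fixes A :: "(int ^ 'n) set"
  assumes "prop_E1 A" "A \<noteq> {}" "A \<subseteq> {m..}"
  obtains x where "x \<in> A" "\<And>y. y \<in> A \<Longrightarrow> x \<le> y"
proof -
  define f where "f x = nat (\<Sum>i\<in>UNIV. x $ i - m $ i)" for x :: "int ^ 'n"
  obtain x where x: "x \<in> A" "\<And>y. y \<in> A \<Longrightarrow> f x \<le> f y"
    using assms(2) ex_has_least_nat[of "\<lambda>x. x \<in> A" _ f] by blast
  have "x \<le> y" if y: "y \<in> A" for y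
  proof (rule ccontr)
    assume "\<not> x \<le> y"
    then obtain j where j: "y $ j < x $ j"
      by (auto simp: vec_le_iff not_le)
    define z where "z = (\<chi> i. min (x $ i) (y $ i))"
    have z: "z \<in> A"
      using assms(1) x(1) y by (auto simp: prop_E1_def z_def)
    have "(\<Sum>i\<in>UNIV. z $ i - m $ i) < (\<Sum>i\<in>UNIV. x $ i - m $ i)"
    proof (rule sum_strict_mono_ex1)
      show "\<exists>i\<in>UNIV. z $ i - m $ i < x $ i - m $ i"
        using j by (intro bexI[of _ j]) (auto simp: z_def)
    qed (auto simp: z_def)
    moreover have "(\<Sum>i\<in>UNIV. z $ i - m $ i) \<ge> 0"
    proof (rule sum_nonneg)
      have "m \<le> z" using assms(3) z by auto
      then show "0 \<le> z $ i - m $ i" for i by (simp add: vec_le_iff)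
    qed
    ultimately have "f z < f x"
      by (simp add: f_def)
    with x(2)[OF z] show False by simp
  qed
  with x(1) that show ?thesis by blast
qed

lemma minimum_least:
  fixes A :: "(int ^ 'n) set"
  assumes "prop_E1 A" "A \<noteq> {}" "A \<subseteq> {m..}"
  shows "minimum A \<in> A" and "\<And>y. y \<in> A \<Longrightarrow> minimum A \<le> y"
proof -
  obtain x where x: "x \<in> A" "\<And>y. y \<in> A \<Longrightarrow> x \<le> y"
    using min_closed_has_least[OF assms] by blast
  then have "minimum A = x"
    unfolding minimum_def by (intro Least_equality)
  with x show "minimum A \<in> A" "\<And>y. y \<in> A \<Longrightarrow> minimum A \<le> y" by auto
qed

text \<open>The corners of orthants inside \<open>A\<close> are again closed under componentwise
  minima, so the \<open>LEAST\<close> in \<open>conductor\<close> is attained.\<close>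

lemma conductor_in:
  fixes A :: "(int ^ 'n) set"
  assumes E1: "prop_E1 A" and "{c..} \<subseteq> A" "A \<subseteq> {m..}"
  shows "conductor A \<in> A"
proof -
  define C where "C = {\<alpha>. {\<alpha>..} \<subseteq> A}"
  have "prop_E1 C"
    unfolding prop_E1_def
  proof (intro ballI)
    fix \<alpha> \<beta> assume *: "\<alpha> \<in> C" "\<beta> \<in> C"
    have "\<delta> \<in> A" if "(\<chi> i. min (\<alpha> $ i) (\<beta> $ i)) \<le> \<delta>" for \<delta>
    proof -
      have "(\<chi> i. max (\<delta> $ i) (\<alpha> $ i)) \<in> A" "(\<chi> i. max (\<delta> $ i) (\<beta> $ i)) \<in> A"
        using * by (auto simp: C_def subset_iff vec_le_iff)
      \<comment> \<open>In each coordinate \<delta> dominates \<alpha> or \<beta>, so one of the two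
        maxima equals \<delta> there and the other is no smaller.\<close>
      moreover have "(\<chi> i. min ((\<chi> i. max (\<delta> $ i) (\<alpha> $ i)) $ i) ((\<chi> i. max (\<delta> $ i) (\<beta> $ i)) $ i)) = \<delta>"
        using that by (auto simp: vec_eq_iff vec_le_iff min_def max_def split: if_splits)
          (metis order.trans linorder_le_cases antisym)+
      ultimately show ?thesis
        using E1 unfolding prop_E1_def by metis
    qed
    then show "(\<chi> i. min (\<alpha> $ i) (\<beta> $ i)) \<in> C"
      by (auto simp: C_def)
  qed
  moreover have "C \<noteq> {}" "C \<subseteq> {m..}"
    using assms by (auto simp: C_def)
  ultimately have "minimum C \<in> C"
    by (rule minimum_least)
  then show ?thesis
    by (auto simp: C_def minimum_def conductor_def)
qed

lemma prop_E1_truncation: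
  "prop_E1 E \<Longrightarrow> prop_E1 (truncation E \<alpha>)"
  by (auto simp: prop_E1_def truncation_def vec_le_iff)

section \<open>Height functions\<close>

text \<open>A discrete potential, unique up to an additive constant. It lives on the whole lattice
  rather than on \<open>E\<close>, so that it can be evaluated at truncation points and
  reflected.\<close>

definition height_function :: "(int ^ 'n) set \<Rightarrow> (int ^ 'n \<Rightarrow> int) \<Rightarrow> bool" where
  "height_function E h \<longleftrightarrow>
     (\<forall>\<alpha> i. h (\<alpha> + axis i 1) = h \<alpha> + of_bool (Delta_bar_at E i \<alpha> \<noteq> {}))"

section \<open>Integration on the lattice and existence of height functions\<close>

lemma int_antidifference:
  fixes g :: "int \<Rightarrow> int"
  shows "\<exists>G. G 0 = 0 \<and> (\<forall>k. G (k + 1) = G k + g k)"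
proof -
  define G where "G k = sum g {0..<k} - sum g {k..<0}" for k
  have "G (k + 1) = G k + g k" for k
  proof (cases "k \<ge> 0")
    case True
    then have "{0..<k+1} = insert k {0..<k}" by auto
    with True show ?thesis by (simp add: G_def)
  next
    case False
    then have "{k..<0} = insert k {k+1..<0}" by auto
    with False show ?thesis by (simp add: G_def)
  qed
  moreover have "G 0 = 0" by (simp add: G_def)
  ultimately show ?thesis by blast
qed

text \<open>A discrete Poincare lemma: the hypothesis says that the increments cancel around every
  unit square. The potential is built by admitting one direction after another.\<close>

lemma closed_form_exact:
  fixes e :: "'n::finite \<Rightarrow> int ^ 'n \<Rightarrow> int"
  assumes closed: "\<And>i j \<alpha>. i \<noteq> j \<Longrightarrow> e i \<alpha> + e j (\<alpha> + axis i 1) = e j \<alpha> + e i (\<alpha> + axis j 1)"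
  shows "\<exists>h. \<forall>\<alpha> i. h (\<alpha> + axis i 1) = h \<alpha> + e i \<alpha>"
proof -
  have "\<exists>h. \<forall>\<alpha>. \<forall>i\<in>A. h (\<alpha> + axis i 1) = h \<alpha> + e i \<alpha>" if "finite A" for A
    using that
  proof induction
    case empty
    show ?case by simp
  next
    case (insert j A)
    obtain h where h: "\<And>\<alpha> i. i \<in> A \<Longrightarrow> h (\<alpha> + axis i 1) = h \<alpha> + e i \<alpha>"
      using insert.IH by blast
    have "\<forall>\<alpha>. \<exists>G. G 0 = 0 \<and> (\<forall>k. G (k + 1) = G k + e j (\<alpha> + axis j k))"
      by (intro allI int_antidifference)
    then obtain G where G0: "\<And>\<alpha>. G \<alpha> 0 = 0"
      and G1: "\<And>\<alpha> k. G \<alpha> (k + 1) = G \<alpha> k + e j (\<alpha> + axis j k)"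
      by metis
    \<comment> \<open>\<open>b\<close> projects to the hyperplane where coordinate \<open>j\<close>
      vanishes. The new potential agrees with the old one there and integrates \<open>e j\<close>
      along the lines in direction \<open>j\<close>.\<close>
    define b where "b \<alpha> = \<alpha> - axis j (\<alpha> $ j)" for \<alpha> :: "int ^ 'n"
    define h' where "h' \<alpha> = h (b \<alpha>) + G (b \<alpha>) (\<alpha> $ j)" for \<alpha>
    have b_axis: "b \<alpha> + axis j (\<alpha> $ j) = \<alpha>" for \<alpha>
      by (simp add: b_def)
    have axis_step: "\<beta> + axis j (k + 1) = \<beta> + axis j k + axis j 1" for \<beta> :: "int ^ 'n" and k :: int
      by (simp add: vec_eq_iff)
    have swap: "\<beta> + axis i 1 + axis j k = \<beta> + axis j k + axis i 1" for \<beta> :: "int ^ 'n" and k i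
      by (simp add: vec_eq_iff)
    have "h' (\<alpha> + axis j 1) = h' \<alpha> + e j \<alpha>" for \<alpha>
    proof -
      have "b (\<alpha> + axis j 1) = b \<alpha>"
        by (simp add: b_def vec_eq_iff)
      then show ?thesis
        by (simp add: h'_def G1 b_axis)
    qed
    moreover have "h' (\<alpha> + axis i 1) = h' \<alpha> + e i \<alpha>" if i: "i \<in> A" for \<alpha> i
    proof -
      have "i \<noteq> j" using i insert.hyps by auto
      have b: "b (\<alpha> + axis i 1) = b \<alpha> + axis i 1"
        using \<open>i \<noteq> j\<close> by (auto simp: b_def vec_eq_iff)
      \<comment> \<open>The square relations telescope along the segment from \<beta> to
        \<open>\<beta> + axis j k\<close>: only the values of \<open>e i\<close> at its two ends
        survive. As \<open>k\<close> may be negative, the induction runs both ways from 0.\<close>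
      have "G (\<beta> + axis i 1) k = G \<beta> k + e i (\<beta> + axis j k) - e i \<beta>" for \<beta> k
      proof (induction k rule: int_induct[where k = 0])
        case base
        have axis_0: "axis j 0 = (0 :: int ^ 'n)" by (simp add: vec_eq_iff)
        show ?case by (simp add: G0 axis_0)
      next
        case (step1 k)
        then show ?case
          using closed[OF \<open>i \<noteq> j\<close>, of "\<beta> + axis j k"]
          unfolding G1 swap[of \<beta> i k] axis_step by linarith
      next
        case (step2 k)
        have k: "\<beta> + axis j k = \<beta> + axis j (k - 1) + axis j 1"
          by (simp add: vec_eq_iff)
        have G: "G \<delta> k = G \<delta> (k - 1) + e j (\<delta> + axis j (k - 1))" for \<delta>
          using G1[of \<delta> "k - 1"] by simp
        have "G (\<beta> + axis i 1) k = G (\<beta> + axis i 1) (k - 1) + e j (\<beta> + axis j (k - 1) + axis i 1)"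
          unfolding G[of "\<beta> + axis i 1"] swap[of \<beta> i "k - 1"] ..
        then show ?case
          using step2 G[of \<beta>] closed[OF \<open>i \<noteq> j\<close>, of "\<beta> + axis j (k - 1)"]
          unfolding k by linarith
      qed
      then show ?thesis
        using \<open>i \<noteq> j\<close> by (simp add: h'_def b h[OF i] b_axis)
    qed
    ultimately show ?case by blast
  qed
  from this[of UNIV] show ?thesis by simp
qed

text \<open>The 0/1 increments are closed around unit squares: by (E2), if a step in direction
  \<open>j\<close> empties the closed \<Delta> for \<open>i\<close>, then a step in direction
  \<open>i\<close> empties the one for \<open>j\<close>.\<close>

lemma height_function_exists:
  fixes E :: "(int ^ 'n) set"
  assumes E2: "prop_E2 E"
  shows "\<exists>h. height_function E h"
proof -
  define e where "e i \<alpha> = (of_bool (Delta_bar_at E i \<alpha> \<noteq> {}) :: int)" for i \<alpha>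
  have anti: "Delta_bar_at E i (\<alpha> + axis j 1) \<noteq> {} \<Longrightarrow> Delta_bar_at E i \<alpha> \<noteq> {}"
    if "i \<noteq> j" for i j \<alpha>
  proof -
    assume "Delta_bar_at E i (\<alpha> + axis j 1) \<noteq> {}"
    then obtain \<beta> where \<beta>: "\<beta> \<in> E" "\<beta> $ i = (\<alpha> + axis j 1) $ i" "\<And>k. (\<alpha> + axis j 1) $ k \<le> \<beta> $ k"
      by (rule Delta_bar_at_nonemptyE) blast
    have "\<alpha> $ k \<le> \<beta> $ k" for k
      using \<beta>(3)[of k] by (simp split: if_splits)
    then show ?thesis
      using \<beta> that by (auto simp: Delta_bar_at_def)
  qed
  have drop: "Delta_bar_at E j \<alpha> \<noteq> {} \<and> Delta_bar_at E j (\<alpha> + axis i 1) = {}"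
    if "i \<noteq> j" and ne: "Delta_bar_at E i \<alpha> \<noteq> {}" and em: "Delta_bar_at E i (\<alpha> + axis j 1) = {}" for i j \<alpha>
  proof -
    obtain \<beta> where \<beta>: "\<beta> \<in> E" "\<beta> $ i = \<alpha> $ i" "\<And>k. \<beta> $ k \<ge> \<alpha> $ k"
      using ne by (rule Delta_bar_at_nonemptyE) blast
    have em': "\<zeta> $ j = \<alpha> $ j" if "\<zeta> \<in> E" "\<zeta> $ i = \<alpha> $ i" "\<And>k. \<zeta> $ k \<ge> \<alpha> $ k" for \<zeta>
    proof (rule ccontr)
      assume "\<zeta> $ j \<noteq> \<alpha> $ j"
      then have "\<zeta> $ j \<ge> \<alpha> $ j + 1" using that(3)[of j] by linarith
      then have "\<zeta> \<in> Delta_bar_at E i (\<alpha> + axis j 1)"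
        using that \<open>i \<noteq> j\<close> by (auto simp: Delta_bar_at_def)
      with em show False by blast
    qed
    have \<beta>j: "\<beta> $ j = \<alpha> $ j" using em' \<beta> by blast
    then have "\<beta> \<in> Delta_bar_at E j \<alpha>"
      using \<beta> by (auto simp: Delta_bar_at_def)
    moreover have "Delta_bar_at E j (\<alpha> + axis i 1) = {}"
    proof (rule ccontr)
      assume "Delta_bar_at E j (\<alpha> + axis i 1) \<noteq> {}"
      then obtain \<zeta> where \<zeta>: "\<zeta> \<in> E" "\<zeta> $ j = \<alpha> $ j" "\<zeta> $ i > \<alpha> $ i" "\<And>k. \<zeta> $ k \<ge> \<alpha> $ k"
      proof (rule Delta_bar_at_nonemptyE)
        fix \<zeta> assume \<zeta>: "\<zeta> \<in> E" "\<zeta> $ j = (\<alpha> + axis i 1) $ j" "\<And>k. (\<alpha> + axis i 1) $ k \<le> \<zeta> $ k"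
        show thesis
        proof (rule that[of \<zeta>])
          show "\<zeta> $ k \<ge> \<alpha> $ k" for k
            using \<zeta>(3)[of k] by (simp split: if_splits)
          show "\<zeta> $ j = \<alpha> $ j" "\<zeta> $ i > \<alpha> $ i"
            using \<zeta>(2) \<zeta>(3)[of i] \<open>i \<noteq> j\<close> by simp_all
        qed (fact \<zeta>(1))
      qed
      \<comment> \<open>(E2) is applied in coordinate \<open>j\<close>, where \<beta> and \<zeta>
        agree. They differ in coordinate \<open>i\<close>, so \<epsilon> takes the value
        \<open>\<alpha> $ i\<close> there while exceeding \<open>\<alpha> $ j\<close> in coordinate
        \<open>j\<close>, against \<open>em'\<close>.\<close>
      obtain \<epsilon> where \<epsilon>: "\<epsilon> \<in> E" "\<epsilon> $ j > \<beta> $ j"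
        "\<And>k. k \<noteq> j \<Longrightarrow> \<epsilon> $ k \<ge> min (\<beta> $ k) (\<zeta> $ k)"
        "\<And>k. k \<noteq> j \<Longrightarrow> \<beta> $ k \<noteq> \<zeta> $ k \<Longrightarrow> \<epsilon> $ k = min (\<beta> $ k) (\<zeta> $ k)"
        using E2 \<beta>(1) \<zeta>(1) \<beta>j \<zeta>(2) unfolding prop_E2_def by metis
      have "\<epsilon> $ i = \<alpha> $ i"
        using \<epsilon>(4)[of i] \<beta>(2) \<zeta>(3) \<open>i \<noteq> j\<close> by auto
      moreover have "\<epsilon> $ k \<ge> \<alpha> $ k" for k
        using \<epsilon>(2) \<epsilon>(3)[of k] \<beta>(3)[of k] \<zeta>(4)[of k] \<beta>j by (cases "k = j") auto
      ultimately show False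
        using em' \<epsilon>(1,2) \<beta>j by fastforce
    qed
    ultimately show ?thesis by blast
  qed
  \<comment> \<open>\<open>A\<close> and \<open>B\<close> stand for the increments at \<alpha> in
    directions \<open>i\<close> and \<open>j\<close>, \<open>C\<close> and \<open>D\<close> for the
    increments in these directions after a step in the other one.\<close>
  have bool_eq: "of_bool A + of_bool D = (of_bool B + of_bool C :: int)"
    if "C \<Longrightarrow> A" "D \<Longrightarrow> B" "A \<Longrightarrow> \<not> C \<Longrightarrow> B \<and> \<not> D" "B \<Longrightarrow> \<not> D \<Longrightarrow> A \<and> \<not> C" for A B C D
    using that by (cases A; cases B; cases C; cases D) simp_all
  have "e i \<alpha> + e j (\<alpha> + axis i 1) = e j \<alpha> + e i (\<alpha> + axis j 1)" if "i \<noteq> j" for i j \<alpha>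
    unfolding e_def
    by (rule bool_eq)
      (use anti[OF that] anti[OF that[symmetric]] drop[OF that] drop[OF that[symmetric]] in blast)+
  then show ?thesis
    using closed_form_exact[of e] unfolding height_function_def e_def by blast
qed

section \<open>Heights and lengths of saturated chains\<close>

lemma constant_on_box:
  fixes a b :: "int ^ 'n" and h :: "int ^ 'n \<Rightarrow> int"
  assumes "\<And>x k. a \<le> x \<Longrightarrow> x \<le> b \<Longrightarrow> x $ k < b $ k \<Longrightarrow> h (x + axis k 1) = h x" and "a \<le> b"
  shows "h b = h a"
  using assms
\<comment> \<open>The lower corner \<open>a\<close> moves by a unit step in a coordinate where it is
  still below \<open>b\<close>. The path thus stays in the box, where steps are known to be
  level.\<close>
proof (induction "nat (\<Sum>k\<in>UNIV. b $ k - a $ k)" arbitrary: a rule: less_induct)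
  case less
  show ?case
  proof (cases "a = b")
    case False
    then have "a < b" using less.prems(2) by simp
    then obtain k where k: "a $ k < b $ k" by (rule vec_less_obtains_index)
    let ?a = "a + axis k 1"
    have le: "a \<le> ?a" "?a \<le> b"
      using k less.prems(2) by (auto simp: vec_le_iff add1_zle_eq)
    have "(\<Sum>l\<in>UNIV. b $ l - ?a $ l) < (\<Sum>l\<in>UNIV. b $ l - a $ l)"
      by (rule sum_strict_mono_ex1) (auto intro!: bexI[of _ k])
    moreover have "(\<Sum>l\<in>UNIV. b $ l - ?a $ l) \<ge> 0"
      using le(2) by (intro sum_nonneg) (simp add: vec_le_iff)
    ultimately have "h b = h ?a"
      using le by (intro less.hyps) (auto intro: less.prems(1) order.trans)
    also have "\<dots> = h a"
      using k less.prems by simp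
    finally show ?thesis .
  qed simp
qed

text \<open>A first unit step from \<alpha> towards \<beta> raises \<open>h\<close>, with \<alpha>
  itself as witness. Every further step up to \<beta> is level, since a witness for it would give an
  element of \<open>E\<close> strictly between \<alpha> and \<beta>.\<close>

lemma height_consecutive:
  fixes E :: "(int ^ 'n) set"
  assumes E1: "prop_E1 E" and h: "height_function E h" and c: "consecutive E \<alpha> \<beta>"
  shows "h \<beta> = h \<alpha> + 1"
proof -
  have \<alpha>\<beta>: "\<alpha> \<in> E" "\<beta> \<in> E" "\<alpha> < \<beta>" and gap: "\<And>\<delta>. \<delta> \<in> E \<Longrightarrow> \<alpha> < \<delta> \<Longrightarrow> \<not> \<delta> < \<beta>"
    using c by (auto simp: consecutive_def)
  obtain i where i: "\<alpha> $ i < \<beta> $ i"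
    using \<alpha>\<beta>(3) by (rule vec_less_obtains_index)
  have "h \<beta> = h (\<alpha> + axis i 1)"
  proof (rule constant_on_box)
    show "\<alpha> + axis i 1 \<le> \<beta>"
      using i less_imp_le[OF \<alpha>\<beta>(3)] by (auto simp: vec_le_iff add1_zle_eq)
    fix x k assume x: "\<alpha> + axis i 1 \<le> x" "x \<le> \<beta>" "x $ k < \<beta> $ k"
    have "Delta_bar_at E k x = {}"
    proof (rule ccontr)
      assume "Delta_bar_at E k x \<noteq> {}"
      then obtain \<zeta> where \<zeta>: "\<zeta> \<in> E" "\<zeta> $ k = x $ k" "\<And>l. \<zeta> $ l \<ge> x $ l"
        by (rule Delta_bar_at_nonemptyE) blast
      \<comment> \<open>Cutting \<zeta> down by \<beta> keeps it above
        \<open>\<alpha> + axis i 1\<close>, hence strictly above \<alpha>, and its coordinate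
        \<open>k\<close> is still \<open>x $ k < \<beta> $ k\<close>.\<close>
      define \<delta> where "\<delta> = (\<chi> l. min (\<zeta> $ l) (\<beta> $ l))"
      have "\<delta> \<in> E"
        using E1 \<zeta>(1) \<alpha>\<beta>(2) by (auto simp: prop_E1_def \<delta>_def)
      moreover have "x \<le> \<delta>"
        using x(2) \<zeta>(3) by (auto simp: vec_le_iff \<delta>_def)
      then have "\<alpha> + axis i 1 \<le> \<delta>"
        using x(1) by simp
      then have "\<alpha> < \<delta>"
        using i by (force simp: vec_le_iff less_le split: if_splits)
      moreover have "\<delta> \<le> \<beta>" "\<delta> $ k \<noteq> \<beta> $ k"
        using \<zeta>(2) x(3) by (auto simp: vec_le_iff \<delta>_def)
      then have "\<delta> < \<beta>" by (auto simp: less_le)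
      ultimately show False using gap by blast
    qed
    then show "h (x + axis k 1) = h x"
      using h by (simp add: height_function_def)
  qed
  moreover have "\<alpha> \<in> Delta_bar_at E i \<alpha>"
    using \<alpha>\<beta>(1) by (simp add: Delta_bar_at_def)
  ultimately show ?thesis
    using h by (auto simp: height_function_def)
qed

text \<open>Telescoping the heights shows that the length depends on the endpoints only, which makes
  the definite description in \<open>chain_dist\<close> unambiguous.\<close>

lemma saturated_chain_height:
  assumes "prop_E1 E" "height_function E h" "saturated_chain E \<alpha> \<beta> n c"
  shows "int n = h \<beta> - h \<alpha>"
proof -
  have "k \<le> n \<Longrightarrow> h (c k) = h \<alpha> + int k" for k
  proof (induction k)
    case 0
    then show ?case using assms(3) by (simp add: saturated_chain_def)
  next
    case (Suc k)
    have "h (c (Suc k)) = h (c k) + 1"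
      using assms Suc.prems by (intro height_consecutive) (auto simp: saturated_chain_def)
    with Suc show ?case by simp
  qed
  from this[of n] show ?thesis
    using assms(3) by (simp add: saturated_chain_def)
qed

text \<open>Endpoints that are neither equal nor consecutive are split at an intermediate element of
  \<open>E\<close>; both halves have smaller coordinate distance, and their chains are
  concatenated.\<close>

lemma saturated_chain_exists:
  fixes \<alpha> \<beta> :: "int ^ 'n"
  assumes "\<alpha> \<in> E" "\<beta> \<in> E" "\<alpha> \<le> \<beta>"
  shows "\<exists>n c. saturated_chain E \<alpha> \<beta> n c"
  using assms
proof (induction "nat (\<Sum>k\<in>UNIV. \<beta> $ k - \<alpha> $ k)" arbitrary: \<alpha> \<beta> rule: less_induct)
  case less
  consider "\<alpha> = \<beta>" | "consecutive E \<alpha> \<beta>" | \<delta> where "\<delta> \<in> E" "\<alpha> < \<delta>" "\<delta> < \<beta>"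
    using less.prems by (auto simp: consecutive_def less_le)
  then show ?case
  proof cases
    case 1
    then have "saturated_chain E \<alpha> \<beta> 0 (\<lambda>_. \<alpha>)"
      using less.prems by (simp add: saturated_chain_def)
    then show ?thesis by blast
  next
    case 2
    then have "saturated_chain E \<alpha> \<beta> 1 (\<lambda>k. if k = 0 then \<alpha> else \<beta>)"
      using less.prems by (simp add: saturated_chain_def)
    then show ?thesis by blast
  next
    case 3
    \<comment> \<open>Serves both halves: an interval shortened at either end has smaller coordinate
      distance. Nonnegativity transfers the comparison to \<open>nat\<close>.\<close>
    have size: "(\<Sum>k\<in>UNIV. y $ k - x $ k) < (\<Sum>k\<in>UNIV. y' $ k - x' $ k) \<and> 0 \<le> (\<Sum>k\<in>UNIV. y $ k - x $ k)"
      if "x' \<le> x" "x \<le> y" "y \<le> y'" and ne: "x' < x \<or> y < y'" for x x' y y' :: "int ^ 'n"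
    proof
      obtain k where "x' $ k < x $ k \<or> y $ k < y' $ k"
        using ne vec_less_obtains_index by metis
      then have k: "y $ k - x $ k < y' $ k - x' $ k"
        using that(1,3) unfolding vec_le_iff by smt
      show "(\<Sum>k\<in>UNIV. y $ k - x $ k) < (\<Sum>k\<in>UNIV. y' $ k - x' $ k)"
        using that(1,3) k by (intro sum_strict_mono_ex1) (auto simp: vec_le_iff intro!: diff_mono)
      show "0 \<le> (\<Sum>k\<in>UNIV. y $ k - x $ k)"
        using that(2) by (intro sum_nonneg) (simp add: vec_le_iff)
    qed
    have le: "\<alpha> \<le> \<delta>" "\<delta> \<le> \<beta>" using 3 by simp_all
    obtain m c where c: "saturated_chain E \<alpha> \<delta> m c"
      using less.hyps[of \<delta> \<alpha>] size[of \<alpha> \<alpha> \<delta> \<beta>] 3 le less.prems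
      by (auto simp: nat_less_eq_zless)
    obtain n d where d: "saturated_chain E \<delta> \<beta> n d"
      using less.hyps[of \<beta> \<delta>] size[of \<alpha> \<delta> \<beta> \<beta>] 3 le less.prems
      by (auto simp: nat_less_eq_zless)
    have "saturated_chain E \<alpha> \<beta> (m + n) (\<lambda>k. if k \<le> m then c k else d (k - m))"
      unfolding saturated_chain_def
    proof (intro conjI allI impI)
      fix k assume k: "k < m + n"
      consider "Suc k \<le> m" | "k = m" | "m < k" by linarith
      then show "consecutive E (if k \<le> m then c k else d (k - m))
                  (if Suc k \<le> m then c (Suc k) else d (Suc k - m))"
      proof cases
        case 2
        then have "c k = d 0" using c d by (simp add: saturated_chain_def)
        then show ?thesis using 2 d k by (auto simp: saturated_chain_def)
      next
        case 3
        then show ?thesis using d k by (auto simp: saturated_chain_def Suc_diff_le)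
      qed (use c in \<open>auto simp: saturated_chain_def\<close>)
    qed (use c d in \<open>auto simp: saturated_chain_def\<close>)
    then show ?thesis by blast
  qed
qed

lemma chain_dist_height:
  assumes "prop_E1 E" "height_function E h" "\<alpha> \<in> E" "\<beta> \<in> E" "\<alpha> \<le> \<beta>"
  shows "int (chain_dist E \<alpha> \<beta>) = h \<beta> - h \<alpha>"
proof -
  obtain n c where nc: "saturated_chain E \<alpha> \<beta> n c"
    using saturated_chain_exists assms(3-5) by blast
  have "chain_dist E \<alpha> \<beta> = n"
    unfolding chain_dist_def
  proof (rule the_equality)
    fix n' assume "\<exists>c. saturated_chain E \<alpha> \<beta> n' c"
    then obtain c' where "saturated_chain E \<alpha> \<beta> n' c'" by blast
    then have "int n' = int n"
      using saturated_chain_height[OF assms(1,2)] nc by metis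
    then show "n' = n" by simp
  qed (use nc in blast)
  then show ?thesis
    using saturated_chain_height[OF assms(1,2) nc] by simp
qed

section \<open>Distances in truncations and the coefficients of the series L\<close>

lemma chain_dist_truncation:
  assumes "\<delta> \<le> \<alpha>"
  shows "chain_dist (truncation E \<delta>) \<alpha> \<beta> = chain_dist E \<alpha> \<beta>"
proof -
  have "saturated_chain (truncation E \<delta>) \<alpha> \<beta> n c \<longleftrightarrow> saturated_chain E \<alpha> \<beta> n c" for n c
  proof
    assume *: "saturated_chain E \<alpha> \<beta> n c"
    \<comment> \<open>A chain starting above \<delta> increases, so it never leaves the truncation.
      Points between its members also lie above \<delta>, so consecutiveness means the same in both
      sets.\<close>
    have "k \<le> n \<Longrightarrow> \<delta> \<le> c k" for k
    proof (induction k)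
      case 0
      then show ?case using * assms by (simp add: saturated_chain_def)
    next
      case (Suc k)
      then have "c k < c (Suc k)" using * by (simp add: saturated_chain_def consecutive_def)
      with Suc show ?case by simp
    qed
    with * show "saturated_chain (truncation E \<delta>) \<alpha> \<beta> n c"
      by (auto simp: saturated_chain_def consecutive_def truncation_def)
  next
    assume "saturated_chain (truncation E \<delta>) \<alpha> \<beta> n c"
    then show "saturated_chain E \<alpha> \<beta> n c"
      unfolding saturated_chain_def consecutive_def truncation_def
      by (auto dest: order.strict_implies_order order.trans)
  qed
  then show ?thesis by (simp add: chain_dist_def)
qed

text \<open>An element of \<open>E\<close> above \<alpha> is never below \<mu> in any coordinate, so
  all unit steps from \<alpha> to \<mu> are level. Heights can thus be read off at \<alpha>
  itself.\<close>

lemma height_minimum_truncation: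
  fixes E :: "(int ^ 'n) set"
  assumes "height_function E h" "\<mu> \<in> truncation E \<alpha>" "\<And>y. y \<in> truncation E \<alpha> \<Longrightarrow> \<mu> \<le> y"
  shows "h \<mu> = h \<alpha>"
proof (rule constant_on_box)
  show "\<alpha> \<le> \<mu>" using assms(2) by (simp add: truncation_def)
  fix x k assume x: "\<alpha> \<le> x" "x \<le> \<mu>" "x $ k < \<mu> $ k"
  have "Delta_bar_at E k x = {}"
  proof (rule ccontr)
    assume "Delta_bar_at E k x \<noteq> {}"
    then obtain \<zeta> where \<zeta>: "\<zeta> \<in> E" "\<zeta> $ k = x $ k" "\<And>l. \<zeta> $ l \<ge> x $ l"
      by (rule Delta_bar_at_nonemptyE) blast
    then have "\<zeta> \<in> truncation E \<alpha>"
      using x(1) by (auto simp: truncation_def vec_le_iff intro: order.trans)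
    then have "\<mu> $ k \<le> \<zeta> $ k"
      using assms(3) by (simp add: vec_le_iff)
    with \<zeta>(2) x(3) show False by simp
  qed
  then show "h (x + axis k 1) = h x"
    using assms(1) by (simp add: height_function_def)
qed

text \<open>Both chains defining the coefficient end at the same conductor, whose height cancels;
  the heights of the starting points remain.\<close>

lemma L_series_height:
  fixes E :: "(int ^ 'n) set"
  assumes E1: "prop_E1 E" and h: "height_function E h" and c: "{c..} \<subseteq> E" and m: "E \<subseteq> {m..}"
  shows "L_series E \<alpha> = h (\<alpha> + 1) - h \<alpha>"
proof -
  let ?\<gamma> = "conductor (truncation E (\<alpha> + 1))"
  have E1': "prop_E1 (truncation E \<delta>)" for \<delta>
    using E1 by (rule prop_E1_truncation)
  have up: "{(\<chi> i. max (c $ i) (\<delta> $ i))..} \<subseteq> truncation E \<delta>" for \<delta>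
    using c by (auto simp: truncation_def vec_le_iff subset_iff)
  then have ne: "truncation E \<delta> \<noteq> {}" for \<delta> by fastforce
  have m': "truncation E \<delta> \<subseteq> {m..}" for \<delta>
    using m by (auto simp: truncation_def)
  note min = minimum_least[OF E1' ne m']
  have \<gamma>: "?\<gamma> \<in> truncation E (\<alpha> + 1)"
    by (rule conductor_in[OF E1' up m'])
  have "int (chain_dist (truncation E \<delta>) (minimum (truncation E \<delta>)) ?\<gamma>) = h ?\<gamma> - h \<delta>"
    if "?\<gamma> \<in> truncation E \<delta>" for \<delta>
  proof -
    have "minimum (truncation E \<delta>) \<le> ?\<gamma>" using min(2) that by blast
    moreover have "minimum (truncation E \<delta>) \<in> E" "\<delta> \<le> minimum (truncation E \<delta>)" "?\<gamma> \<in> E"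
      using min(1)[of \<delta>] that by (auto simp: truncation_def)
    ultimately show ?thesis
      using chain_dist_height[OF E1 h] height_minimum_truncation[OF h min(1) min(2)]
      by (simp add: chain_dist_truncation)
  qed
  moreover have "?\<gamma> \<in> truncation E \<alpha>"
    using \<gamma> by (auto simp: truncation_def vec_le_iff) (smt (verit))
  ultimately show ?thesis
    using \<gamma> by (simp add: L_series_def ideal_dist_def)
qed

section \<open>Duality\<close>

lemma Delta_empty_iff: "Delta E \<alpha> = {} \<longleftrightarrow> (\<forall>i. Delta_at E i \<alpha> = {})"
  by (simp add: Delta_def)

text \<open>Adding \<beta> carries a point of \<Delta> of \<open>S\<close> at
  \<open>\<tau> - (\<alpha> + \<beta>)\<close> to one of \<Delta> of \<open>E\<close> at
  \<open>\<tau> - \<alpha>\<close>. Conversely, a point \<zeta> of the latter puts 0 into the former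
  for \<open>\<beta> = \<zeta>\<close>.\<close>

lemma ideal_diff_canonical:
  fixes S E :: "(int ^ 'n) set"
  assumes "0 \<in> S" and ideal: "\<And>\<alpha> \<beta>. \<alpha> \<in> E \<Longrightarrow> \<beta> \<in> S \<Longrightarrow> \<alpha> + \<beta> \<in> E"
  shows "ideal_diff (canonical_ideal S) E = {\<alpha>. Delta E (conductor S - 1 - \<alpha>) = {}}"
proof -
  let ?\<tau> = "conductor S - 1"
  have "Delta_at S i (?\<tau> - (\<alpha> + \<beta>)) = {}" if em: "Delta_at E i (?\<tau> - \<alpha>) = {}" and \<beta>: "\<beta> \<in> E" for \<alpha> \<beta> i
  proof (rule ccontr)
    assume "Delta_at S i (?\<tau> - (\<alpha> + \<beta>)) \<noteq> {}"
    then obtain \<sigma> where \<sigma>: "\<sigma> \<in> S" "\<sigma> $ i = (?\<tau> - (\<alpha> + \<beta>)) $ i"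
      "\<And>j. j \<noteq> i \<Longrightarrow> \<sigma> $ j > (?\<tau> - (\<alpha> + \<beta>)) $ j"
      unfolding Delta_at_def by blast
    have "(\<beta> + \<sigma>) $ j > (?\<tau> - \<alpha>) $ j" if "j \<noteq> i" for j
      using \<sigma>(3)[OF that] by simp
    then have "\<beta> + \<sigma> \<in> Delta_at E i (?\<tau> - \<alpha>)"
      using ideal[OF \<beta> \<sigma>(1)] \<sigma>(2) by (simp add: Delta_at_def)
    with em show False by blast
  qed
  moreover have "Delta_at E i (?\<tau> - \<alpha>) = {}" if *: "\<And>\<beta>. \<beta> \<in> E \<Longrightarrow> Delta_at S i (?\<tau> - (\<alpha> + \<beta>)) = {}" for \<alpha> i
  proof (rule ccontr)
    assume "Delta_at E i (?\<tau> - \<alpha>) \<noteq> {}"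
    then obtain \<zeta> where \<zeta>: "\<zeta> \<in> E" "\<zeta> $ i = (?\<tau> - \<alpha>) $ i" "\<And>j. j \<noteq> i \<Longrightarrow> \<zeta> $ j > (?\<tau> - \<alpha>) $ j"
      unfolding Delta_at_def by blast
    have "(0 :: int ^ 'n) $ j > (?\<tau> - (\<alpha> + \<zeta>)) $ j" if "j \<noteq> i" for j
      using \<zeta>(3)[OF that] by simp
    then have "0 \<in> Delta_at S i (?\<tau> - (\<alpha> + \<zeta>))"
      using \<open>0 \<in> S\<close> \<zeta>(2) by (simp add: Delta_at_def)
    with *[OF \<zeta>(1)] show False by blast
  qed
  ultimately show ?thesis
    unfolding ideal_diff_def canonical_ideal_def Delta_empty_iff by blast
qed

text \<open>
  While some \<open>\<Delta>\<^sub>k(\<rho>)\<close> with \<open>k \<noteq> i\<close> is nonempty, lower \<open>\<rho>\<close> in direction \<open>k\<close>. By (E2) this keeps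
  \<open>\<Delta>\<^sub>i(\<rho>)\<close> empty: a new element of it and an element of \<open>\<Delta>\<^sub>k(\<rho>)\<close> agree in coordinate \<open>k\<close> and
  differ in coordinate \<open>i\<close>, so they would produce an element of the old \<open>\<Delta>\<^sub>i(\<rho>)\<close>.
\<close>
lemma Delta_descent:
  fixes E :: "(int ^ 'n) set"
  assumes E2: "prop_E2 E" and m: "E \<subseteq> {m..}" and "Delta_at E i \<rho> = {}"
  shows "\<exists>\<rho>'. \<rho>' \<le> \<rho> \<and> \<rho>' $ i = \<rho> $ i \<and> Delta E \<rho>' = {}"
  using assms(3)
\<comment> \<open>\<open>nat\<close> is applied per coordinate, as \<rho> need not lie above
  \<open>m\<close>. The lowered coordinate satisfies
  \<open>\<rho> $ k = \<beta> $ k \<ge> m $ k\<close>, so its summand is positive and really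
  drops.\<close>
proof (induction "\<Sum>k\<in>UNIV. nat (\<rho> $ k - m $ k + 1)" arbitrary: \<rho> rule: less_induct)
  case less
  show ?case
  proof (cases "Delta E \<rho> = {}")
    case False
    then obtain k \<beta> where \<beta>: "\<beta> \<in> Delta_at E k \<rho>"
      by (auto simp: Delta_def)
    then have ki: "k \<noteq> i" using less.prems by auto
    have \<beta>': "\<beta> \<in> E" "\<beta> $ k = \<rho> $ k" "\<And>l. l \<noteq> k \<Longrightarrow> \<beta> $ l > \<rho> $ l"
      using \<beta> by (auto simp: Delta_at_def)
    let ?\<rho> = "\<rho> - axis k 1"
    have "m $ k \<le> \<beta> $ k"
      using \<beta>'(1) m by (auto simp: vec_le_iff)
    with \<beta>'(2) have "(\<Sum>l\<in>UNIV. nat (?\<rho> $ l - m $ l + 1)) < (\<Sum>l\<in>UNIV. nat (\<rho> $ l - m $ l + 1))"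
      by (intro sum_strict_mono_ex1) (auto intro!: bexI[of _ k])
    moreover have "Delta_at E i ?\<rho> = {}"
    proof (rule ccontr)
      assume "Delta_at E i ?\<rho> \<noteq> {}"
      then obtain \<zeta> where \<zeta>: "\<zeta> \<in> E" "\<zeta> $ i = \<rho> $ i" "\<zeta> $ k \<ge> \<rho> $ k"
        "\<And>l. l \<noteq> i \<Longrightarrow> l \<noteq> k \<Longrightarrow> \<zeta> $ l > \<rho> $ l"
        using ki unfolding Delta_at_def by (fastforce split: if_splits)
      have "\<zeta> $ k = \<rho> $ k"
      proof (rule ccontr)
        assume "\<zeta> $ k \<noteq> \<rho> $ k"
        with \<zeta> have "\<zeta> \<in> Delta_at E i \<rho>" by (force simp: Delta_at_def)
        with less.prems show False by blast
      qed
      then obtain \<epsilon> where \<epsilon>: "\<epsilon> \<in> E" "\<epsilon> $ k > \<beta> $ k"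
        "\<And>l. l \<noteq> k \<Longrightarrow> \<epsilon> $ l \<ge> min (\<beta> $ l) (\<zeta> $ l)"
        "\<And>l. l \<noteq> k \<Longrightarrow> \<beta> $ l \<noteq> \<zeta> $ l \<Longrightarrow> \<epsilon> $ l = min (\<beta> $ l) (\<zeta> $ l)"
        using E2 \<beta>'(1,2) \<zeta>(1) unfolding prop_E2_def by metis
      have "\<epsilon> $ i = \<rho> $ i"
        using \<epsilon>(4)[of i] \<beta>'(3)[of i] \<zeta>(2) ki by auto
      moreover have "\<epsilon> $ l > \<rho> $ l" if "l \<noteq> i" for l
        using \<epsilon>(2) \<epsilon>(3)[of l] \<beta>'(2) \<beta>'(3)[of l] \<zeta>(4)[of l] that by (cases "l = k") auto
      ultimately have "\<epsilon> \<in> Delta_at E i \<rho>"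
        using \<epsilon>(1) by (simp add: Delta_at_def)
      with less.prems show False by blast
    qed
    ultimately obtain \<rho>' where "\<rho>' \<le> ?\<rho>" "\<rho>' $ i = ?\<rho> $ i" "Delta E \<rho>' = {}"
      using less.hyps[of ?\<rho>] by blast
    moreover have "?\<rho> \<le> \<rho>" by (simp add: vec_le_iff)
    ultimately show ?thesis
      using ki by (intro exI[of _ \<rho>']) auto
  qed blast
qed

lemma dual_Delta_bar_iff:
  fixes E :: "(int ^ 'n) set" and \<gamma> \<beta> :: "int ^ 'n"
  assumes E2: "prop_E2 E" and m: "E \<subseteq> {m..}"
  defines "F \<equiv> {\<alpha>. Delta E (\<gamma> - 1 - \<alpha>) = {}}"
  shows "Delta_bar_at F i \<beta> \<noteq> {} \<longleftrightarrow> Delta_bar_at E i (\<gamma> - \<beta> - axis i 1) = {}"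
proof
  assume "Delta_bar_at F i \<beta> \<noteq> {}"
  then obtain \<delta> where \<delta>: "\<delta> \<in> F" "\<delta> $ i = \<beta> $ i" "\<And>j. \<delta> $ j \<ge> \<beta> $ j"
    by (rule Delta_bar_at_nonemptyE) blast
  show "Delta_bar_at E i (\<gamma> - \<beta> - axis i 1) = {}"
  proof (rule ccontr)
    assume "Delta_bar_at E i (\<gamma> - \<beta> - axis i 1) \<noteq> {}"
    then obtain \<zeta> where \<zeta>: "\<zeta> \<in> E" "\<zeta> $ i = \<gamma> $ i - \<beta> $ i - 1" "\<And>j. j \<noteq> i \<Longrightarrow> \<zeta> $ j \<ge> \<gamma> $ j - \<beta> $ j"
      unfolding Delta_bar_at_def by fastforce
    have "\<zeta> $ j > \<gamma> $ j - 1 - \<delta> $ j" if "j \<noteq> i" for j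
      using \<zeta>(3)[OF that] \<delta>(3)[of j] by linarith
    then have "\<zeta> \<in> Delta_at E i (\<gamma> - 1 - \<delta>)"
      using \<zeta>(1,2) \<delta>(2) by (auto simp: Delta_at_def)
    with \<delta>(1) show False by (auto simp: F_def Delta_def)
  qed
next
  assume em: "Delta_bar_at E i (\<gamma> - \<beta> - axis i 1) = {}"
  \<comment> \<open>Over the integers, the strict bounds at \<open>\<gamma> - 1 - \<beta>\<close>
    are the weak bounds at \<open>\<gamma> - \<beta> - axis i 1\<close>, and coordinate
    \<open>i\<close> is the same.\<close>
  have "Delta_at E i (\<gamma> - 1 - \<beta>) = {}"
  proof (rule ccontr)
    assume "Delta_at E i (\<gamma> - 1 - \<beta>) \<noteq> {}"
    then obtain \<zeta> where "\<zeta> \<in> Delta_at E i (\<gamma> - 1 - \<beta>)" by blast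
    then have "\<zeta> \<in> Delta_bar_at E i (\<gamma> - \<beta> - axis i 1)"
      by (fastforce simp: Delta_at_def Delta_bar_at_def)
    with em show False by blast
  qed
  then obtain \<rho> where \<rho>: "\<rho> \<le> \<gamma> - 1 - \<beta>" "\<rho> $ i = (\<gamma> - 1 - \<beta>) $ i" "Delta E \<rho> = {}"
    using Delta_descent[OF E2 m] by blast
  \<comment> \<open>Lowering \<rho> away from coordinate \<open>i\<close> raises its reflection,
    which the closed \<Delta> of \<open>F\<close> at \<beta> permits.\<close>
  have "\<gamma> - 1 - \<rho> \<in> F"
    using \<rho>(3) by (simp add: F_def)
  then have "\<gamma> - 1 - \<rho> \<in> Delta_bar_at F i \<beta>"
    using \<rho>(1,2) by (auto simp: Delta_bar_at_def vec_le_iff) (smt (verit))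
  then show "Delta_bar_at F i \<beta> \<noteq> {}" by blast
qed

text \<open>A unit step raises the coordinate sum by 1, and the reflected \<open>h\<close> takes
  this back exactly when the closed \<Delta> of \<open>E\<close> is nonempty, that is, when the dual
  one is empty.\<close>

lemma dual_height_function:
  fixes E :: "(int ^ 'n) set"
  assumes "prop_E2 E" "E \<subseteq> {m..}" and h: "height_function E h"
  shows "height_function {\<alpha>. Delta E (\<gamma> - 1 - \<alpha>) = {}} (\<lambda>\<beta>. (\<Sum>i\<in>UNIV. \<beta> $ i) + h (\<gamma> - \<beta>))"
  unfolding height_function_def
proof (intro allI)
  fix \<beta> :: "int ^ 'n" and i
  have "(\<Sum>j\<in>UNIV. (\<beta> + axis i 1) $ j) = (\<Sum>j\<in>UNIV. \<beta> $ j) + 1"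
    by (simp add: sum.distrib)
  moreover have "h (\<gamma> - \<beta>) = h (\<gamma> - \<beta> - axis i 1) + of_bool (Delta_bar_at E i (\<gamma> - \<beta> - axis i 1) \<noteq> {})"
    using h unfolding height_function_def by (metis diff_add_cancel)
  moreover have step: "\<gamma> - (\<beta> + axis i 1) = \<gamma> - \<beta> - axis i 1"
    by (simp add: vec_eq_iff)
  ultimately show "(\<Sum>j\<in>UNIV. (\<beta> + axis i 1) $ j) + h (\<gamma> - (\<beta> + axis i 1)) =
      (\<Sum>j\<in>UNIV. \<beta> $ j) + h (\<gamma> - \<beta>) +
      of_bool (Delta_bar_at {\<alpha>. Delta E (\<gamma> - 1 - \<alpha>) = {}} i \<beta> \<noteq> {})"
    unfolding dual_Delta_bar_iff[OF assms(1,2)] step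
    by (auto simp: of_bool_def simp del: vector_add_component)
qed

text \<open>The minimum has coordinate \<open>i\<close> in common with \<alpha> or \<beta> and lies
  below both, so a point of its reflected \<Delta> in direction \<open>i\<close> also belongs to
  that of \<alpha> or \<beta>.\<close>

lemma prop_E1_dual: "prop_E1 {\<alpha>. Delta E (\<gamma> - 1 - \<alpha>) = {}}"
  unfolding prop_E1_def
proof (intro ballI)
  fix \<alpha> \<beta> assume *: "\<alpha> \<in> {\<alpha>. Delta E (\<gamma> - 1 - \<alpha>) = {}}" "\<beta> \<in> {\<alpha>. Delta E (\<gamma> - 1 - \<alpha>) = {}}"
  let ?\<mu> = "\<chi> i. min (\<alpha> $ i) (\<beta> $ i)"
  have "\<zeta> \<notin> Delta_at E i (\<gamma> - 1 - ?\<mu>)" for \<zeta> i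
  proof
    assume \<zeta>: "\<zeta> \<in> Delta_at E i (\<gamma> - 1 - ?\<mu>)"
    have "\<zeta> \<in> Delta_at E i (\<gamma> - 1 - \<alpha>) \<or> \<zeta> \<in> Delta_at E i (\<gamma> - 1 - \<beta>)"
      using \<zeta> by (cases "\<alpha> $ i \<le> \<beta> $ i") (force simp: Delta_at_def)+
    with * show False by (auto simp: Delta_def)
  qed
  then show "?\<mu> \<in> {\<alpha>. Delta E (\<gamma> - 1 - \<alpha>) = {}}"
    by (auto simp: Delta_def)
qed

text \<open>Reflecting a point above \<open>\<gamma> - m\<close> gives one strictly below
  \<open>m\<close> in every coordinate, with which no element of \<open>E\<close> can share a
  coordinate.\<close>

lemma dual_upper:
  assumes "E \<subseteq> {m..}"
  shows "{\<gamma> - m..} \<subseteq> {\<alpha>. Delta E (\<gamma> - 1 - \<alpha>) = {}}"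
proof
  fix \<alpha> assume "\<alpha> \<in> {\<gamma> - m..}"
  then have "\<gamma> $ i - m $ i \<le> \<alpha> $ i" for i
    by (simp add: vec_le_iff)
  then have "\<gamma> $ i - 1 - \<alpha> $ i < m $ i" for i
    by (smt (verit))
  moreover have "m $ i \<le> \<zeta> $ i" if "\<zeta> \<in> E" for \<zeta> i
    using assms that by (auto simp: vec_le_iff subset_iff)
  ultimately show "\<alpha> \<in> {\<alpha>. Delta E (\<gamma> - 1 - \<alpha>) = {}}"
    by (auto simp: Delta_def Delta_at_def) (metis not_le)
qed

lemma dual_lower:
  assumes "{c..} \<subseteq> E"
  shows "{\<alpha>. Delta E (\<gamma> - 1 - \<alpha>) = {}} \<subseteq> {\<gamma> - c..}"
proof (intro subsetI, rule ccontr)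
  fix \<alpha> assume \<alpha>: "\<alpha> \<in> {\<alpha>. Delta E (\<gamma> - 1 - \<alpha>) = {}}" "\<alpha> \<notin> {\<gamma> - c..}"
  then obtain i where i: "\<alpha> $ i < \<gamma> $ i - c $ i"
    by (auto simp: vec_le_iff not_le)
  \<comment> \<open>Coordinate \<open>i\<close> is forced and is at least \<open>c $ i\<close>; the
    others are large enough both to stay in the orthant at \<open>c\<close> and to exceed
    \<open>\<gamma> - 1 - \<alpha>\<close>.\<close>
  define \<zeta> where "\<zeta> = (\<chi> j. if j = i then \<gamma> $ i - 1 - \<alpha> $ i else max (c $ j) (\<gamma> $ j - \<alpha> $ j))"
  have "\<zeta> \<in> E"
    using assms i by (auto simp: subset_iff vec_le_iff \<zeta>_def)
  then have "\<zeta> \<in> Delta_at E i (\<gamma> - 1 - \<alpha>)"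
    by (auto simp: Delta_at_def \<zeta>_def)
  with \<alpha>(1) show False by (auto simp: Delta_def)
qed

section \<open>Reflection of the Poincare series\<close>

lemma laurent_mult_superset:
  assumes "finite A" "Poly_Mapping.keys p \<subseteq> A"
  shows "laurent_mult p f \<alpha> = (\<Sum>\<beta>\<in>A. Poly_Mapping.lookup p \<beta> * f (\<alpha> - \<beta>))"
  unfolding laurent_mult_def
  by (rule sum.mono_neutral_left) (use assms in \<open>auto simp: in_keys_iff\<close>)

lemma laurent_mult_diff:
  "laurent_mult (p - q) f \<alpha> = laurent_mult p f \<alpha> - laurent_mult q f \<alpha>"
proof -
  let ?A = "Poly_Mapping.keys p \<union> Poly_Mapping.keys q"
  have "Poly_Mapping.keys (p - q) \<subseteq> ?A"
    by (auto simp: in_keys_iff lookup_minus)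
  then show ?thesis
    by (subst (1 2 3) laurent_mult_superset[of ?A])
       (auto simp: lookup_minus algebra_simps sum_subtractf)
qed

text \<open>Multiplication by a monomial translates the support by \<delta>, and the sum is
  reindexed along this translation.\<close>

lemma laurent_mult_monom_mult:
  "laurent_mult (laurent_monom 1 \<delta> * p) f \<alpha> = laurent_mult p f (\<alpha> - \<delta>)"
proof -
  have lk: "Poly_Mapping.lookup (laurent_monom 1 \<delta> * p) (\<delta> + \<beta>) = Poly_Mapping.lookup p \<beta>" for \<beta>
  proof -
    have "Poly_Mapping.lookup (laurent_monom 1 \<delta> * p) (\<delta> + \<beta>) =
        (\<Sum>a. (\<Sum>q. Poly_Mapping.lookup p q when \<delta> + \<beta> = a + q) when a = \<delta>)"
      by (simp add: laurent_monom_def lookup_mult lookup_single when_def if_distrib if_distribR cong: if_cong)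
    then show ?thesis by simp
  qed
  have "Poly_Mapping.keys (laurent_monom 1 \<delta> * p) \<subseteq> (+) \<delta> ` Poly_Mapping.keys p"
  proof
    fix \<beta> assume "\<beta> \<in> Poly_Mapping.keys (laurent_monom 1 \<delta> * p)"
    then have "\<beta> - \<delta> \<in> Poly_Mapping.keys p"
      using lk[of "\<beta> - \<delta>"] by (simp add: in_keys_iff)
    then show "\<beta> \<in> (+) \<delta> ` Poly_Mapping.keys p"
      by (intro image_eqI[of _ _ "\<beta> - \<delta>"]) auto
  qed
  then have "laurent_mult (laurent_monom 1 \<delta> * p) f \<alpha> =
      (\<Sum>\<beta>\<in>(+) \<delta> ` Poly_Mapping.keys p. Poly_Mapping.lookup (laurent_monom 1 \<delta> * p) \<beta> * f (\<alpha> - \<beta>))"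
    by (intro laurent_mult_superset) auto
  also have "\<dots> = (\<Sum>\<beta>\<in>Poly_Mapping.keys p. Poly_Mapping.lookup p \<beta> * f (\<alpha> - (\<delta> + \<beta>)))"
    by (subst sum.reindex) (auto simp: lk)
  finally show ?thesis
    by (simp add: laurent_mult_def algebra_simps)
qed

lemma laurent_mult_one: "laurent_mult 1 f = f"
  using laurent_mult_monom[of 1 0 f] by (simp add: laurent_monom_def)

lemma laurent_mult_prod_insert:
  assumes "finite A" "j \<notin> A"
  shows "laurent_mult (\<Prod>i\<in>insert j A. laurent_monom 1 (axis i 1) - 1) f \<alpha> =
    laurent_mult (\<Prod>i\<in>A. laurent_monom 1 (axis i 1) - 1) f (\<alpha> - axis j 1) -
    laurent_mult (\<Prod>i\<in>A. laurent_monom 1 (axis i 1) - 1) f \<alpha>"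
  using assms by (simp add: left_diff_distrib laurent_mult_diff laurent_mult_monom_mult)

text \<open>Each factor acts as a difference operator. The first one kills the constant
  \<open>s\<close>, so the induction starts at a singleton. Reflection reverses each difference,
  costing a sign and a shift by \<open>axis j 1\<close>; the extra sign comes from
  \<open>- f\<close>.\<close>

lemma laurent_mult_prod_reflect:
  fixes f g :: "('n::finite) series"
  assumes g: "\<And>\<alpha>. g \<alpha> = s - f (\<gamma> - 1 - \<alpha>)" and "finite A" "A \<noteq> {}"
  shows "laurent_mult (\<Prod>i\<in>A. laurent_monom 1 (axis i 1) - 1) g \<alpha> =
    (-1) ^ (card A + 1) *
      laurent_mult (\<Prod>i\<in>A. laurent_monom 1 (axis i 1) - 1) f (\<gamma> - 1 - \<alpha> + (\<Sum>i\<in>A. axis i 1))"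
  using assms(2,3)
proof (induction arbitrary: \<alpha> rule: finite_ne_induct)
  case (singleton j)
  show ?case
  proof -
    have single: "laurent_mult (\<Prod>i\<in>{j}. laurent_monom 1 (axis i 1) - 1) k \<beta> = k (\<beta> - axis j 1) - k \<beta>"
      for k :: "'n series" and \<beta>
      using laurent_mult_prod_insert[of "{}" j k \<beta>] by (simp add: laurent_mult_one)
    show ?thesis unfolding single g by (simp add: algebra_simps)
  qed
next
  case (insert j A)
  have "\<gamma> - 1 - (\<alpha> - axis j 1) + (\<Sum>i\<in>A. axis i 1) = \<gamma> - 1 - \<alpha> + (\<Sum>i\<in>insert j A. axis i 1)"
    and "\<gamma> - 1 - \<alpha> + (\<Sum>i\<in>A. axis i 1) = \<gamma> - 1 - \<alpha> + (\<Sum>i\<in>insert j A. axis i 1) - axis j 1"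
    using insert.hyps by (auto simp: algebra_simps)
  then show ?case
    unfolding laurent_mult_prod_insert[OF insert.hyps(1,3)] insert.IH
    using insert.hyps by (simp add: algebra_simps)
qed

lemma sum_axis_eq_one: "(\<Sum>i\<in>UNIV. axis i 1) = (1 :: int ^ 'n)"
  by (simp add: vec_eq_iff)

theorem theorem42:
  fixes S E K KE :: "(int ^ 'n) set" and \<gamma> \<tau> \<mu>E \<gamma>E :: "int ^ 'n"
  assumes S: "good_semigroup S"
    and E: "good_ideal S E"
    and K: "K = canonical_ideal S"
    and KE: "KE = ideal_diff K E"
    and \<gamma>: "\<gamma> = conductor S"
    and \<tau>: "\<tau> = \<gamma> - 1"
    and \<mu>E: "\<mu>E = minimum E"
    and \<gamma>E: "\<gamma>E = conductor E"
    and conditions: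
      "ideal_dist {\<mu>E..} E = ideal_dist KE {\<gamma> - \<mu>E..}
       \<or> ideal_dist E (truncation E \<gamma>E) =
           ideal_dist {\<mu>E..} {\<gamma>E..} - ideal_dist KE (truncation KE (\<gamma> - \<mu>E))
       \<or> (\<forall>\<alpha> i. \<mu>E \<le> \<alpha> \<and> \<alpha> \<le> \<gamma>E \<and> \<alpha> + axis i 1 \<le> \<gamma>E \<longrightarrow>
            (Delta_bar_at E i \<alpha> \<noteq> {} \<longleftrightarrow> Delta_at KE i (\<tau> - \<alpha>) = {}))
       \<or> (\<forall>\<alpha> i. \<mu>E \<le> \<alpha> \<and> \<alpha> \<le> \<gamma>E \<and> \<alpha> - axis i 1 \<ge> \<mu>E \<longrightarrow>
            (Delta_bar_at KE i (\<tau> - \<alpha>) \<noteq> {} \<longleftrightarrow> Delta_at E i \<alpha> = {}))"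
  shows "poincare_series KE =
           laurent_mult (laurent_monom ((-1) ^ (CARD('n) + 1)) \<gamma>) (invert_vars (poincare_series E))"
proof -
  have E1: "prop_E1 E" and E2: "prop_E2 E"
    using E by (auto simp: good_ideal_def)
  have ideal: "\<And>\<alpha> \<beta>. \<alpha> \<in> E \<Longrightarrow> \<beta> \<in> S \<Longrightarrow> \<alpha> + \<beta> \<in> E"
    using E by (auto simp: good_ideal_def semigroup_ideal_def)
  have KE_eq: "KE = {\<alpha>. Delta E (\<gamma> - 1 - \<alpha>) = {}}"
    unfolding KE K \<gamma> using S ideal by (intro ideal_diff_canonical) (auto simp: good_semigroup_def)
  obtain \<sigma> where \<sigma>: "\<And>\<beta>. \<beta> \<in> E \<Longrightarrow> \<sigma> + \<beta> \<in> S"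
    using E by (auto simp: good_ideal_def semigroup_ideal_def)
  \<comment> \<open>A translate of \<open>E\<close> by \<sigma> lies in \<open>S\<close>, hence in
    the nonnegative orthant.\<close>
  have lower: "E \<subseteq> {- \<sigma>..}"
  proof
    fix \<beta> assume "\<beta> \<in> E"
    then have "0 \<le> \<sigma> + \<beta>"
      using \<sigma> S by (auto simp: good_semigroup_def)
    then show "\<beta> \<in> {- \<sigma>..}"
      by (auto simp: vec_le_iff) (smt (verit))
  qed
  obtain \<epsilon> a where \<epsilon>: "\<epsilon> \<in> E" and a: "{a..} \<subseteq> S"
    using S E by (auto simp: good_ideal_def semigroup_ideal_def good_semigroup_def prop_E0_def)
  have upper: "{\<epsilon> + a..} \<subseteq> E"
  proof
    fix \<beta> assume "\<beta> \<in> {\<epsilon> + a..}"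
    then have "a \<le> \<beta> - \<epsilon>"
      by (auto simp: vec_le_iff algebra_simps)
    then have "\<beta> - \<epsilon> \<in> S" using a by auto
    then show "\<beta> \<in> E" using ideal[OF \<epsilon>] by fastforce
  qed
  obtain h where h: "height_function E h"
    using height_function_exists[OF E2] by blast
  have LE: "L_series E \<alpha> = h (\<alpha> + 1) - h \<alpha>" for \<alpha>
    by (rule L_series_height[OF E1 h upper lower])
  have LKE: "L_series KE \<alpha> = int CARD('n) - L_series E (\<gamma> - 1 - \<alpha>)" for \<alpha>
  proof -
    have "L_series KE \<alpha> = (\<Sum>i\<in>UNIV. (\<alpha> + 1) $ i) + h (\<gamma> - (\<alpha> + 1))
        - ((\<Sum>i\<in>UNIV. \<alpha> $ i) + h (\<gamma> - \<alpha>))"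
      unfolding KE_eq
      by (rule L_series_height[OF prop_E1_dual dual_height_function[OF E2 lower h]
            dual_upper[OF lower] dual_lower[OF upper]])
    \<comment> \<open>The coordinate sums of \<open>\<alpha> + 1\<close> and \<alpha> differ by the
      number of coordinates; the two values of \<open>h\<close> left over form minus the coefficient
      of \<open>L_series E\<close> at \<open>\<gamma> - 1 - \<alpha>\<close>.\<close>
    moreover have "\<gamma> - (\<alpha> + 1) = \<gamma> - 1 - \<alpha>" "\<gamma> - 1 - \<alpha> + 1 = \<gamma> - \<alpha>" by simp_all
    ultimately show ?thesis
      by (simp add: LE sum.distrib)
  qed
  show ?thesis
  proof
    fix \<alpha>
    \<comment> \<open>With all factors present the accumulated shift is the all-ones vector, which
      turns \<open>\<gamma> - 1 - \<alpha>\<close> into \<open>\<gamma> - \<alpha>\<close>.\<close>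
    have "poincare_series KE \<alpha> = (-1) ^ (CARD('n) + 1) * poincare_series E (\<gamma> - \<alpha>)"
      unfolding poincare_series_def
      by (subst laurent_mult_prod_reflect[where f = "L_series E" and \<gamma> = \<gamma>, OF LKE]) (simp_all add: sum_axis_eq_one)
    then show "poincare_series KE \<alpha> =
        laurent_mult (laurent_monom ((-1) ^ (CARD('n) + 1)) \<gamma>) (invert_vars (poincare_series E)) \<alpha>"
      by (simp add: laurent_mult_monom invert_vars_def)
  qed
qed

end
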